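(* Let $A,B>0$ with $A\neq B$, let $0<x_0<1$, let $g\in L^1([0,1])$ (extended by $0$ to $\mathbb{R}$), and let $a(x)=A\,H(x_0-x)+B\,H(x-x_0)$. Let $\mathcal M,\mathcal N\subset\mathbb{R}^2$ be an admissible exceptional pair for $(A,B,x_0)$ (defined in the context), and let $P_1,P_2\in\mathbb{R}$ satisfy one of the following: (i) $P_1<0$ and $P_2<0$; (ii) $P_1>0$, $P_2>0$ and $(P_1,P_2)\notin\mathcal M$; (iii) $P_1>0$, $P_2<0$ and $(P_1,P_2)\notin\mathcal N$. Let $(\widetilde u_-,\widetilde u_+)$ be the unique solution of the transmission problem (T) stated in the context, and define $$u_-(x)=\begin{cases}\widetilde u_-(x), & x\in[0,x_0],\\ 0,& x\in[x_0,1],\end{cases}\qquad u_+(x)=\begin{cases}0,& x\in[0,x_0],\\ \widetilde u_+(x),& x\in[x_0,1]\end{cases}$$ (the value at the single point $x_0$ being immaterial). Then $u:=u_-+u_+$ (extended by $0$ outside $[0,1]$) is a solution, in the distributional sense defined in the context, of the problem $(a\cdot u)''+P\cdot u=g$ on $[0,1]$, $u(0)=u(1)=0$, with $P(x)=P_1+H(x-x_0)(P_2-P_1)$.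
   Context: $H$ denotes the Heaviside function. $\dot{\mathcal D}'([0,1]):=\{v\in\mathcal D'(\mathbb{R}) : \operatorname{supp} v\subseteq[0,1]\}$. Transmission problem (T), for given $A,B,x_0,P_1,P_2,g$: find $\widetilde u_-$ on $(0,x_0)$ and $\widetilde u_+$ on $(x_0,1)$ with $$A\widetilde u_-''+P_1\widetilde u_-=g|_{(0,x_0)},\qquad B\widetilde u_+''+P_2\widetilde u_+=g|_{(x_0,1)},$$ $\widetilde u_-(0)=0$, $\widetilde u_+(1)=0$, and $$A\widetilde u_-(x_0)=B\widetilde u_+(x_0),\qquad A\widetilde u_-'(x_0)=B\widetilde u_+'(x_0),$$ where values at the endpoints are one-sided limits. Admissible exceptional pair for $(A,B,x_0)$: one-dimensional submanifolds $\mathcal M,\mathcal N$ of $\mathbb{R}^2$ such that, for every $g\in L^1([0,1])$ and all $P_1,P_2$ satisfying one of (i), (ii), (iii) in the claim, the problem (T) has a unique solution. (The paper shows that such a pair exists.) Model product: a model delta net is given by specifying $\varphi\in\mathcal D(\mathbb{R})$ with $\int\varphi=1$ and putting $\varphi_\varepsilon(x)=\varphi(x/\varepsilon)/\varepsilon$, $\varepsilon>0$. For $v,w\in\mathcal D'(\mathbb{R})$ the model product is $[v\cdot w]:=\lim_{\varepsilon\to0}(v*\varphi_\varepsilon)(w*\varphi_\varepsilon)$; it is said to exist if this limit exists in $\mathcal D'(\mathbb{R})$ for every model delta net and is independent of the choice of the model delta net. Solution: $u\in\dot{\mathcal D}'([0,1])$ is called a solution if the model product $[a\cdot u]$ exists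 in $\mathcal D'(\mathbb{R})$ (which implies that $[P\cdot u]$ exists as well) and the equation $([a\cdot u])''+[P\cdot u]=g$ holds in $\mathcal D'(\mathbb{R})$.
   Formalization: The equation is proved in D'(R) only up to constant multiples of point masses at 0 and 1: with u extended by 0 it fails literally, e.g. au=x(x-1) on [0,1] gives (au)''=2-δ_0-δ_1. It holds exactly off {0,1}; u(0)=u(1)=0 is stated as values and one-sided limits. *)

theory Defs
  imports "HOL-Analysis.Analysis"
begin

section \<open>Smooth functions and test functions\<close>

definition nth_vderiv :: "nat \<Rightarrow> (real \<Rightarrow> 'a::real_normed_vector) \<Rightarrow> real \<Rightarrow> 'a" where
  "nth_vderiv n f = ((\<lambda>h x. vector_derivative h (at x)) ^^ n) f"

text \<open>To be used for open sets only: the derivatives are two-sided.\<close>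

definition smooth_on :: "real set \<Rightarrow> (real \<Rightarrow> 'a::real_normed_vector) \<Rightarrow> bool" where
  "smooth_on S f \<longleftrightarrow> (\<forall>n. \<forall>x\<in>S. nth_vderiv n f differentiable (at x))"

definition fsupport :: "(real \<Rightarrow> complex) \<Rightarrow> real set" where
  "fsupport f = closure {x. f x \<noteq> 0}"

definition test_fun :: "(real \<Rightarrow> complex) set" where
  "test_fun = {\<psi>. smooth_on UNIV \<psi> \<and> compact (fsupport \<psi>)}"

section \<open>Distributions on the real line\<close>

text \<open>
  A distribution is represented by a functional on all functions, of which only the values on
  test functions matter; equality of distributions is agreement on all test functions.
  Scalars are complex.
\<close>

definition distribution :: "((real \<Rightarrow> complex) \<Rightarrow> complex) \<Rightarrow> bool" where
  "distribution T \<longleftrightarrow>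
     (\<forall>\<psi>\<in>test_fun. \<forall>\<theta>\<in>test_fun. T (\<lambda>x. \<psi> x + \<theta> x) = T \<psi> + T \<theta>) \<and>
     (\<forall>c. \<forall>\<psi>\<in>test_fun. T (\<lambda>x. c * \<psi> x) = c * T \<psi>) \<and>
     (\<forall>K. compact K \<longrightarrow>
        (\<exists>C N. \<forall>\<psi>\<in>test_fun. fsupport \<psi> \<subseteq> K \<longrightarrow>
           norm (T \<psi>) \<le> C * (\<Sum>n\<le>N. SUP x. norm (nth_vderiv n \<psi> x))))"

definition dsupport :: "((real \<Rightarrow> complex) \<Rightarrow> complex) \<Rightarrow> real set" where
  "dsupport T =
     {x. \<not> (\<exists>U. open U \<and> x \<in> U \<and> (\<forall>\<psi>\<in>test_fun. fsupport \<psi> \<subseteq> U \<longrightarrow> T \<psi> = 0))}"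

definition dist_deriv :: "((real \<Rightarrow> complex) \<Rightarrow> complex) \<Rightarrow> (real \<Rightarrow> complex) \<Rightarrow> complex" where
  "dist_deriv T \<psi> = - T (\<lambda>x. vector_derivative \<psi> (at x))"

text \<open>The regular distribution of a locally integrable function.\<close>

definition reg_dist :: "(real \<Rightarrow> complex) \<Rightarrow> (real \<Rightarrow> complex) \<Rightarrow> complex" where
  "reg_dist f \<psi> = (LINT x|lebesgue. f x * \<psi> x)"

section \<open>The model product\<close>

definition dist_conv ::
    "((real \<Rightarrow> complex) \<Rightarrow> complex) \<Rightarrow> (real \<Rightarrow> complex) \<Rightarrow> real \<Rightarrow> complex" where
  "dist_conv T \<phi> x = T (\<lambda>y. \<phi> (x - y))"

definition model_net :: "(real \<Rightarrow> complex) \<Rightarrow> real \<Rightarrow> real \<Rightarrow> complex" where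
  "model_net \<phi> \<epsilon> x = \<phi> (x / \<epsilon>) / of_real \<epsilon>"

text \<open>
  \<open>model_product v w T\<close>: the model product of \<open>v\<close> and \<open>w\<close> exists and equals \<open>T\<close>. The same \<open>T\<close>
  serves for every mollifier, which is the independence of the choice of the model delta net.
  Convergence is pointwise on test functions.
\<close>

definition model_product ::
    "((real \<Rightarrow> complex) \<Rightarrow> complex) \<Rightarrow> ((real \<Rightarrow> complex) \<Rightarrow> complex) \<Rightarrow>
     ((real \<Rightarrow> complex) \<Rightarrow> complex) \<Rightarrow> bool" where
  "model_product v w T \<longleftrightarrow> distribution T \<and>
     (\<forall>\<phi>\<in>test_fun. (LINT x|lebesgue. \<phi> x) = 1 \<longrightarrow>
        (\<forall>\<psi>\<in>test_fun.
           ((\<lambda>\<epsilon>. reg_dist (\<lambda>x. dist_conv v (model_net \<phi> \<epsilon>) x * dist_conv w (model_net \<phi> \<epsilon>) x) \<psi>)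
              \<longlongrightarrow> T \<psi>) (at_right 0)))"

section \<open>Distributional solutions\<close>

text \<open>
  The equation \<open>([a \<cdot> u])'' + [P \<cdot> u] = g\<close> on \<open>[0,1]\<close> with \<open>u(0) = u(1) = 0\<close>, for \<open>u\<close> with support
  in \<open>[0,1]\<close>. Pitfall: since \<open>u\<close> is continued by zero, a jump of the derivative of \<open>a u\<close> at
  \<open>0\<close> or \<open>1\<close> contributes a point mass there to \<open>([a \<cdot> u])''\<close>, and Dirichlet conditions do not make
  these jumps vanish: for \<open>u = x (x - 1) / a\<close> on \<open>[0,1]\<close> one gets
  \<open>(a u)'' = 2 - \<delta>\<^sub>0 - \<delta>\<^sub>1\<close> (with \<open>2\<close> cut off to \<open>[0,1]\<close>). So the equation is required as an identity
  of distributions on the whole line up to multiples of the point masses at \<open>0\<close> and \<open>1\<close>. In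
  particular it holds without corrections on \<open>(0,1)\<close>, indeed off \<open>{0,1}\<close>. Derivatives of
  point masses are not allowed; they would stem from nonzero boundary values of \<open>u\<close>.
\<close>

definition distributional_solution ::
    "((real \<Rightarrow> complex) \<Rightarrow> complex) \<Rightarrow> ((real \<Rightarrow> complex) \<Rightarrow> complex) \<Rightarrow>
     ((real \<Rightarrow> complex) \<Rightarrow> complex) \<Rightarrow> ((real \<Rightarrow> complex) \<Rightarrow> complex) \<Rightarrow> bool" where
  "distributional_solution a P g u \<longleftrightarrow>
     distribution u \<and> dsupport u \<subseteq> {0..1} \<and>
     (\<exists>au Pu. model_product a u au \<and> model_product P u Pu \<and>
        (\<exists>c\<^sub>0 c\<^sub>1. \<forall>\<psi>\<in>test_fun.
           dist_deriv (dist_deriv au) \<psi> + Pu \<psi> = g \<psi> + c\<^sub>0 * \<psi> 0 + c\<^sub>1 * \<psi> 1))"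

section \<open>The transmission problem\<close>

text \<open>
  \<open>c v'' + p v = g\<close> on \<open>(l,r)\<close> for integrable \<open>g\<close>: \<open>v\<close> is differentiable with derivative \<open>v'\<close>, and \<open>v'\<close>
  is locally absolutely continuous (written as: \<open>v'\<close> is an indefinite integral of some locally
  integrable \<open>v''\<close>), and the equation holds almost everywhere.
\<close>

definition ode_solution ::
    "real \<Rightarrow> real \<Rightarrow> (real \<Rightarrow> complex) \<Rightarrow> real \<Rightarrow> real \<Rightarrow>
     (real \<Rightarrow> complex) \<Rightarrow> (real \<Rightarrow> complex) \<Rightarrow> bool" where
  "ode_solution c p g l r v v' \<longleftrightarrow>
     (\<forall>x\<in>{l<..<r}. (v has_vector_derivative v' x) (at x)) \<and>
     (\<exists>v''.
        (\<forall>s t. l < s \<and> s \<le> t \<and> t < r \<longrightarrow>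
           v'' absolutely_integrable_on {s..t} \<and> v' t - v' s = integral {s..t} v'') \<and>
        (AE x in lebesgue. x \<in> {l<..<r} \<longrightarrow> of_real c * v'' x + of_real p * v x = g x))"

definition transmission_solution ::
    "real \<Rightarrow> real \<Rightarrow> real \<Rightarrow> real \<Rightarrow> real \<Rightarrow> (real \<Rightarrow> complex) \<Rightarrow>
     (real \<Rightarrow> complex) \<Rightarrow> (real \<Rightarrow> complex) \<Rightarrow> bool" where
  "transmission_solution A B x\<^sub>0 P\<^sub>1 P\<^sub>2 g um up \<longleftrightarrow>
     (\<exists>um' up'.
        ode_solution A P\<^sub>1 g 0 x\<^sub>0 um um' \<and> ode_solution B P\<^sub>2 g x\<^sub>0 1 up up' \<and>
        (um \<longlongrightarrow> 0) (at_right 0) \<and> (up \<longlongrightarrow> 0) (at_left 1) \<and>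
        (\<exists>y\<^sub>m y\<^sub>p. (um \<longlongrightarrow> y\<^sub>m) (at_left x\<^sub>0) \<and> (up \<longlongrightarrow> y\<^sub>p) (at_right x\<^sub>0) \<and>
           of_real A * y\<^sub>m = of_real B * y\<^sub>p) \<and>
        (\<exists>z\<^sub>m z\<^sub>p. (um' \<longlongrightarrow> z\<^sub>m) (at_left x\<^sub>0) \<and> (up' \<longlongrightarrow> z\<^sub>p) (at_right x\<^sub>0) \<and>
           of_real A * z\<^sub>m = of_real B * z\<^sub>p))"

text \<open>Only the values of \<open>um\<close> on \<open>(0,x\<^sub>0)\<close> and of \<open>up\<close> on \<open>(x\<^sub>0,1)\<close> are meaningful.\<close>

definition uniquely_solvable ::
    "real \<Rightarrow> real \<Rightarrow> real \<Rightarrow> real \<Rightarrow> real \<Rightarrow> (real \<Rightarrow> complex) \<Rightarrow> bool" where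
  "uniquely_solvable A B x\<^sub>0 P\<^sub>1 P\<^sub>2 g \<longleftrightarrow>
     (\<exists>um up. transmission_solution A B x\<^sub>0 P\<^sub>1 P\<^sub>2 g um up) \<and>
     (\<forall>um up vm vp.
        transmission_solution A B x\<^sub>0 P\<^sub>1 P\<^sub>2 g um up \<and> transmission_solution A B x\<^sub>0 P\<^sub>1 P\<^sub>2 g vm vp \<longrightarrow>
        (\<forall>x\<in>{0<..<x\<^sub>0}. um x = vm x) \<and> (\<forall>x\<in>{x\<^sub>0<..<1}. up x = vp x))"

section \<open>Admissible exceptional pairs\<close>

text \<open>Smooth embedded submanifolds of dimension one: local parametrisations by smooth immersions
  of an interval that are homeomorphisms onto a relatively open part of the set.\<close>

definition one_dim_submanifold :: "(real \<times> real) set \<Rightarrow> bool" where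
  "one_dim_submanifold M \<longleftrightarrow>
     (\<forall>p\<in>M. \<exists>U \<gamma> \<delta>. open U \<and> p \<in> U \<and>
        smooth_on {-1<..<1} \<gamma> \<and>
        (\<forall>t\<in>{-1<..<1}. vector_derivative \<gamma> (at t) \<noteq> 0) \<and>
        homeomorphism {-1<..<1} (M \<inter> U) \<gamma> \<delta>)"

definition parameter_case :: "(real \<times> real) set \<Rightarrow> (real \<times> real) set \<Rightarrow> real \<Rightarrow> real \<Rightarrow> bool" where
  "parameter_case M N P\<^sub>1 P\<^sub>2 \<longleftrightarrow>
     (P\<^sub>1 < 0 \<and> P\<^sub>2 < 0) \<or>
     (P\<^sub>1 > 0 \<and> P\<^sub>2 > 0 \<and> (P\<^sub>1, P\<^sub>2) \<notin> M) \<or>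
     (P\<^sub>1 > 0 \<and> P\<^sub>2 < 0 \<and> (P\<^sub>1, P\<^sub>2) \<notin> N)"

definition admissible_exceptional_pair ::
    "real \<Rightarrow> real \<Rightarrow> real \<Rightarrow> (real \<times> real) set \<Rightarrow> (real \<times> real) set \<Rightarrow> bool" where
  "admissible_exceptional_pair A B x\<^sub>0 M N \<longleftrightarrow>
     one_dim_submanifold M \<and> one_dim_submanifold N \<and>
     (\<forall>g P\<^sub>1 P\<^sub>2. g absolutely_integrable_on {0..1} \<and> parameter_case M N P\<^sub>1 P\<^sub>2 \<longrightarrow>
        uniquely_solvable A B x\<^sub>0 P\<^sub>1 P\<^sub>2 g)"

section \<open>Coefficients and gluing\<close>

text \<open>The values of the following functions at the jump are immaterial.\<close>

definition heaviside :: "real \<Rightarrow> real" where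
  "heaviside x = (if x > 0 then 1 else 0)"

definition coeff_a :: "real \<Rightarrow> real \<Rightarrow> real \<Rightarrow> real \<Rightarrow> real" where
  "coeff_a A B x\<^sub>0 x = A * heaviside (x\<^sub>0 - x) + B * heaviside (x - x\<^sub>0)"

definition coeff_P :: "real \<Rightarrow> real \<Rightarrow> real \<Rightarrow> real \<Rightarrow> real" where
  "coeff_P P\<^sub>1 P\<^sub>2 x\<^sub>0 x = P\<^sub>1 + heaviside (x - x\<^sub>0) * (P\<^sub>2 - P\<^sub>1)"

text \<open>The open intervals give the right values at \<open>0\<close> and \<open>1\<close>, where the one-sided limits of a solution
  of the transmission problem vanish.\<close>

definition glue :: "real \<Rightarrow> (real \<Rightarrow> complex) \<Rightarrow> (real \<Rightarrow> complex) \<Rightarrow> real \<Rightarrow> complex" where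
  "glue x\<^sub>0 um up x = (if x \<in> {0<..<x\<^sub>0} then um x else 0) + (if x \<in> {x\<^sub>0<..<1} then up x else 0)"

end

theory Submission
  imports Defs
begin

text \<open>
  The product. Each piece of \<open>u\<close> is continuous with one-sided limits at its endpoints, so \<open>u\<close> is a
  bounded Borel function, continuous except possibly at \<open>0\<close>, \<open>x\<^sub>0\<close> and \<open>1\<close>; the coefficients \<open>a\<close> and \<open>P\<close> are
  step functions. Mollifications of a bounded function are bounded uniformly in \<open>\<epsilon>\<close> and converge to it
  wherever it is continuous. By dominated convergence the model products of \<open>a\<close> and \<open>P\<close> with \<open>u\<close> are
  therefore the regular distributions of the pointwise products (\<open>model_product_reg_dist\<close>).

  The equation. Put \<open>h = g - P u\<close>, an integrable function on \<open>[0,1]\<close>. On either side of \<open>x\<^sub>0\<close> the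
  differential equation says that the flux, \<open>A um'\<close> or \<open>B up'\<close>, is a constant plus the primitive of \<open>h\<close>
  (\<open>ode_solution_first_integral\<close>), and the transmission condition for the derivatives makes the two
  constants equal. The transmission condition for the values makes \<open>a u\<close> continuous across \<open>x\<^sub>0\<close>. Two
  integrations by parts (\<open>integral_mult_second_derivative\<close>) then give \<open>(a u)'' = h\<close> without any
  contribution from \<open>x\<^sub>0\<close>. The Dirichlet conditions remove the derivatives of point masses at \<open>0\<close> and \<open>1\<close>,
  and only the point masses themselves, weighted up to sign by the one-sided derivatives of \<open>a u\<close>,
  remain there.

  The second integration by parts involves the primitive of a function that is merely integrable. It is
  an application of Fubini's theorem (\<open>integral_primitive_by_parts\<close>).
\<close>

section \<open>Test functions\<close>

lemma test_fun_has_vector_derivative: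
  assumes "\<psi> \<in> test_fun"
  shows "(\<psi> has_vector_derivative vector_derivative \<psi> (at x)) (at x)"
proof -
  have "nth_vderiv 0 \<psi> differentiable at x"
    using assms unfolding test_fun_def smooth_on_def by blast
  then show ?thesis
    by (simp add: nth_vderiv_def vector_derivative_works)
qed

lemma continuous_on_test_fun:
  assumes "\<psi> \<in> test_fun"
  shows "continuous_on S \<psi>"
  using test_fun_has_vector_derivative[OF assms]
  by (meson continuous_at_imp_continuous_on has_vector_derivative_continuous)

lemma borel_measurable_test_fun: "\<psi> \<in> test_fun \<Longrightarrow> \<psi> \<in> borel_measurable borel"
  using continuous_on_test_fun borel_measurable_continuous_onI by blast

lemma test_fun_vector_derivative:
  assumes "\<psi> \<in> test_fun"
  shows "(\<lambda>x. vector_derivative \<psi> (at x)) \<in> test_fun"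
proof -
  let ?d = "\<lambda>x. vector_derivative \<psi> (at x)"
  have shift: "nth_vderiv n ?d = nth_vderiv (Suc n) \<psi>" for n
    unfolding nth_vderiv_def funpow_Suc_right comp_def ..
  have smooth: "smooth_on UNIV ?d"
    using assms unfolding test_fun_def smooth_on_def shift by blast
  have "fsupport ?d \<subseteq> fsupport \<psi>"
    unfolding fsupport_def
  proof (rule closure_minimal)
    show "{x. ?d x \<noteq> 0} \<subseteq> closure {x. \<psi> x \<noteq> 0}"
    proof (rule subsetI, rule ccontr)
      fix x assume x: "x \<in> {x. ?d x \<noteq> 0}" and out: "x \<notin> closure {x. \<psi> x \<noteq> 0}"
      have "(\<psi> has_vector_derivative 0) (at x)"
      proof (rule has_vector_derivative_transform_within_open)
        show "((\<lambda>_. 0) has_vector_derivative 0) (at x)" by simp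
        show "open (- closure {x. \<psi> x \<noteq> 0})" by auto
        show "x \<in> - closure {x. \<psi> x \<noteq> 0}" using out by auto
        show "0 = \<psi> y" if "y \<in> - closure {x. \<psi> x \<noteq> 0}" for y
          using that closure_subset[of "{x. \<psi> x \<noteq> 0}"] by auto
      qed
      then have "?d x = 0" by (rule vector_derivative_at)
      with x show False by simp
    qed
  qed simp
  then have "fsupport ?d = fsupport \<psi> \<inter> fsupport ?d" by blast
  moreover have "compact (fsupport \<psi> \<inter> fsupport ?d)"
    using assms by (intro compact_Int_closed) (auto simp: test_fun_def fsupport_def)
  ultimately have "compact (fsupport ?d)" by (simp only:)
  with smooth show ?thesis by (simp add: test_fun_def)
qed

lemma test_fun_eq_0: "x \<notin> fsupport \<psi> \<Longrightarrow> \<psi> x = 0"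
  unfolding fsupport_def using closure_subset[of "{x. \<psi> x \<noteq> 0}"] by auto

lemma integrable_test_fun:
  assumes "\<psi> \<in> test_fun"
  shows "integrable lborel \<psi>"
proof -
  have "integrable lborel (\<lambda>x. indicator (fsupport \<psi>) x *\<^sub>R \<psi> x)"
    using assms by (intro borel_integrable_compact continuous_on_test_fun) (auto simp: test_fun_def)
  moreover have "(\<lambda>x. indicator (fsupport \<psi>) x *\<^sub>R \<psi> x) = \<psi>"
  proof
    fix x
    show "indicator (fsupport \<psi>) x *\<^sub>R \<psi> x = \<psi> x"
      using test_fun_eq_0[of x \<psi>] by (cases "x \<in> fsupport \<psi>") simp_all
  qed
  ultimately show ?thesis by (simp only:)
qed

lemma bdd_above_norm_test_fun:
  assumes "\<psi> \<in> test_fun"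
  shows "bdd_above (range (\<lambda>x. norm (\<psi> x)))"
proof -
  have "compact (\<psi> ` fsupport \<psi>)"
    using assms by (intro compact_continuous_image continuous_on_test_fun) (auto simp: test_fun_def)
  from compact_imp_bounded[OF this] obtain C where "\<forall>y\<in>\<psi> ` fsupport \<psi>. norm y \<le> C"
    unfolding bounded_iff by blast
  then have C: "norm (\<psi> x) \<le> C" if "x \<in> fsupport \<psi>" for x
    using that by blast
  have "norm (\<psi> x) \<le> max C 0" for x
  proof (cases "x \<in> fsupport \<psi>")
    case True
    then show ?thesis using C[OF True] by linarith
  next
    case False
    then have "\<psi> x = 0" by (rule test_fun_eq_0)
    then show ?thesis by simp
  qed
  then show ?thesis by (rule bdd_aboveI2)
qed

section \<open>Regular distributions of bounded functions\<close>

lemma integrable_bounded_mult: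
  fixes f k :: "real \<Rightarrow> complex"
  assumes f: "f \<in> borel_measurable borel" "\<And>x. norm (f x) \<le> C" and k: "integrable lborel k"
  shows "integrable lborel (\<lambda>x. f x * k x)"
proof (rule Bochner_Integration.integrable_bound)
  show "integrable lborel (\<lambda>x. of_real C * k x)" using k by simp
  show "(\<lambda>x. f x * k x) \<in> borel_measurable lborel" using f k by measurable
  have "norm (f x) \<le> \<bar>C\<bar>" for x using f(2)[of x] by linarith
  then show "AE x in lborel. norm (f x * k x) \<le> norm (of_real C * k x)"
    by (auto simp: norm_mult intro!: mult_right_mono)
qed

lemma reg_dist_lborel:
  assumes "f \<in> borel_measurable borel" "\<psi> \<in> borel_measurable borel"
  shows "reg_dist f \<psi> = (LINT x|lborel. f x * \<psi> x)"
  unfolding reg_dist_def using assms by (intro integral_completion) simp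

lemma distribution_reg_dist:
  assumes f: "f \<in> borel_measurable borel" "\<And>x. norm (f x) \<le> C"
  shows "distribution (reg_dist f)"
  unfolding distribution_def
proof (intro conjI ballI allI impI)
  fix \<psi> \<theta> assume *: "\<psi> \<in> test_fun" "\<theta> \<in> test_fun"
  note [measurable] = f(1) *[THEN borel_measurable_test_fun]
  show "reg_dist f (\<lambda>x. \<psi> x + \<theta> x) = reg_dist f \<psi> + reg_dist f \<theta>"
    using integrable_bounded_mult[OF f] *[THEN integrable_test_fun]
    by (simp add: reg_dist_lborel distrib_left)
next
  fix c \<psi> assume *: "\<psi> \<in> test_fun"
  note [measurable] = f(1) borel_measurable_test_fun[OF *]
  show "reg_dist f (\<lambda>x. c * \<psi> x) = c * reg_dist f \<psi>"
    by (simp add: reg_dist_lborel mult.left_commute)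
next
  fix K :: "real set" assume K: "compact K"
  have [measurable]: "K \<in> sets borel" using K by (simp add: borel_compact)
  have C: "0 \<le> C" using f(2)[of 0] norm_ge_zero order_trans by blast
  have "norm (reg_dist f \<psi>) \<le> (C * measure lborel K) * (\<Sum>n\<le>0. SUP x. norm (nth_vderiv n \<psi> x))"
    if \<psi>: "\<psi> \<in> test_fun" and supp: "fsupport \<psi> \<subseteq> K" for \<psi>
  proof -
    note [measurable] = f(1) borel_measurable_test_fun[OF \<psi>]
    define s where "s = (SUP x. norm (\<psi> x))"
    have s: "norm (\<psi> x) \<le> s" for x
      unfolding s_def using bdd_above_norm_test_fun[OF \<psi>] by (auto intro: cSUP_upper)
    have "norm (reg_dist f \<psi>) = norm (LINT x|lborel. f x * \<psi> x)"
      by (simp add: reg_dist_lborel)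
    also have "\<dots> \<le> (LINT x|lborel. indicator K x *\<^sub>R (C * s))"
    proof (rule Bochner_Integration.integral_norm_bound_integral)
      show "integrable lborel (\<lambda>x. f x * \<psi> x)"
        by (rule integrable_bounded_mult[OF f integrable_test_fun[OF \<psi>]])
      show "integrable lborel (\<lambda>x. indicator K x *\<^sub>R (C * s))"
        using borel_integrable_compact[OF K continuous_on_const] .
      show "norm (f x * \<psi> x) \<le> indicator K x *\<^sub>R (C * s)" for x
      proof (cases "x \<in> K")
        case True
        then show ?thesis
          using f(2)[of x] s[of x] C by (auto simp: norm_mult intro!: mult_mono)
      next
        case False
        then have "\<psi> x = 0" using supp test_fun_eq_0 by blast
        with False show ?thesis by simp
      qed
    qed
    also have "\<dots> = (C * measure lborel K) * s"
      by simp
    finally show ?thesis by (simp add: s_def nth_vderiv_def)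
  qed
  then show "\<exists>C N. \<forall>\<psi>\<in>test_fun. fsupport \<psi> \<subseteq> K \<longrightarrow>
      norm (reg_dist f \<psi>) \<le> C * (\<Sum>n\<le>N. SUP x. norm (nth_vderiv n \<psi> x))"
    by blast
qed

lemma dsupport_reg_dist_subset:
  assumes "closed S" and "\<And>x. x \<notin> S \<Longrightarrow> f x = 0"
  shows "dsupport (reg_dist f) \<subseteq> S"
proof (rule subsetI, rule ccontr)
  fix x assume x: "x \<in> dsupport (reg_dist f)" "x \<notin> S"
  have "reg_dist f \<psi> = 0" if "fsupport \<psi> \<subseteq> - S" for \<psi>
  proof -
    have "(\<lambda>y. f y * \<psi> y) = (\<lambda>_. 0)"
      using that assms(2) test_fun_eq_0[of _ \<psi>] by fastforce
    then show ?thesis by (simp add: reg_dist_def)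
  qed
  moreover have "open (- S)" using assms by auto
  ultimately show False using x unfolding dsupport_def by blast
qed

lemma reg_dist_eq_integral:
  fixes f \<psi> :: "real \<Rightarrow> complex"
  assumes "(\<lambda>x. f x * \<psi> x) absolutely_integrable_on {a..b}" and "\<And>x. x \<notin> {a..b} \<Longrightarrow> f x = 0"
  shows "reg_dist f \<psi> = integral {a..b} (\<lambda>x. f x * \<psi> x)"
proof -
  have "(\<lambda>x. indicator {a..b} x *\<^sub>R (f x * \<psi> x)) = (\<lambda>x. f x * \<psi> x)"
    using assms(2) by (auto simp: indicator_def)
  then have "reg_dist f \<psi> = (LINT x:{a..b}|lebesgue. f x * \<psi> x)"
    by (simp add: reg_dist_def set_lebesgue_integral_def)
  then show ?thesis using set_lebesgue_integral_eq_integral(2)[OF assms(1)] by simp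
qed

lemma absolutely_integrable_bounded_borel:
  fixes f :: "real \<Rightarrow> complex"
  assumes f: "f \<in> borel_measurable borel" "\<And>x. norm (f x) \<le> C"
  shows "f absolutely_integrable_on {a..b}"
proof -
  have "integrable lborel (\<lambda>x. indicator {a..b} x *\<^sub>R (1::complex))"
    by (rule borel_integrable_compact) auto
  from integrable_bounded_mult[OF f this]
  have "integrable lborel (\<lambda>x. indicator {a..b} x *\<^sub>R f x)"
    by (simp add: scaleR_conv_of_real mult.commute)
  moreover have "(\<lambda>x. indicator {a..b} x *\<^sub>R f x) \<in> borel_measurable lborel"
    using f(1) by simp
  ultimately show ?thesis
    unfolding set_integrable_def by (subst integrable_completion)
qed

section \<open>The model product of bounded, almost everywhere continuous functions\<close>

text \<open>The substitution \<open>y = x - \<epsilon> z\<close> moves the scaling from the mollifier to the argument of \<open>f\<close>.\<close>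

lemma dist_conv_model_net:
  assumes [measurable]: "f \<in> borel_measurable borel" and \<phi>: "\<phi> \<in> test_fun" and \<epsilon>: "\<epsilon> > 0"
  shows "dist_conv (reg_dist f) (model_net \<phi> \<epsilon>) x = (LINT z|lborel. f (x - \<epsilon> * z) * \<phi> z)"
proof -
  note [measurable] = borel_measurable_test_fun[OF \<phi>]
  have "dist_conv (reg_dist f) (model_net \<phi> \<epsilon>) x
      = (LINT y|lborel. f y * (\<phi> ((x - y) / \<epsilon>) / of_real \<epsilon>))"
    unfolding dist_conv_def model_net_def by (rule reg_dist_lborel) measurable
  also have "\<dots> = \<bar>- \<epsilon>\<bar> *\<^sub>R (LINT z|lborel. f (x + - \<epsilon> * z) *
      (\<phi> ((x - (x + - \<epsilon> * z)) / \<epsilon>) / of_real \<epsilon>))"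
    using \<epsilon> by (intro lborel_integral_real_affine) auto
  also have "\<dots> = (LINT z|lborel. \<epsilon> *\<^sub>R (f (x - \<epsilon> * z) * (\<phi> z / of_real \<epsilon>)))"
    using \<epsilon> by simp
  also have "\<dots> = (LINT z|lborel. f (x - \<epsilon> * z) * \<phi> z)"
    using \<epsilon> by (simp add: scaleR_conv_of_real)
  finally show ?thesis .
qed

lemma norm_mollified_le:
  assumes f: "f \<in> borel_measurable borel" "\<And>x. norm (f x) \<le> C" and \<phi>: "\<phi> \<in> test_fun"
  shows "norm (LINT z|lborel. f (x - \<epsilon> * z) * \<phi> z) \<le> C * (LINT z|lborel. norm (\<phi> z))"
proof -
  note [measurable] = f(1)
  have "norm (LINT z|lborel. f (x - \<epsilon> * z) * \<phi> z) \<le> (LINT z|lborel. C * norm (\<phi> z))"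
  proof (rule Bochner_Integration.integral_norm_bound_integral)
    show "integrable lborel (\<lambda>z. f (x - \<epsilon> * z) * \<phi> z)"
      using f(2) by (intro integrable_bounded_mult integrable_test_fun \<phi>) auto
    show "integrable lborel (\<lambda>z. C * norm (\<phi> z))"
      using integrable_test_fun[OF \<phi>] by simp
  qed (auto simp: norm_mult intro!: mult_right_mono f(2))
  then show ?thesis by simp
qed

lemma mollified_tendsto:
  assumes f: "f \<in> borel_measurable borel" "\<And>x. norm (f x) \<le> C" and \<phi>: "\<phi> \<in> test_fun"
    and cont: "isCont f x" and X: "X \<longlonglongrightarrow> 0"
  shows "(\<lambda>n. LINT z|lborel. f (x - X n * z) * \<phi> z) \<longlonglongrightarrow> f x * (LINT z|lborel. \<phi> z)"
proof -
  note [measurable] = f(1) borel_measurable_test_fun[OF \<phi>]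
  have "(\<lambda>n. LINT z|lborel. f (x - X n * z) * \<phi> z) \<longlonglongrightarrow> (LINT z|lborel. f x * \<phi> z)"
  proof (rule integral_dominated_convergence)
    show "integrable lborel (\<lambda>z. C * norm (\<phi> z))"
      using integrable_test_fun[OF \<phi>] by simp
    have "(\<lambda>n. f (x - X n * z) * \<phi> z) \<longlonglongrightarrow> f x * \<phi> z" for z
    proof -
      have "(\<lambda>n. x - X n * z) \<longlonglongrightarrow> x - 0 * z" by (intro tendsto_intros X)
      then have "(\<lambda>n. f (x - X n * z)) \<longlonglongrightarrow> f x"
        using isCont_tendsto_compose[OF cont] by simp
      then show ?thesis by (rule tendsto_mult_right)
    qed
    then show "AE z in lborel. (\<lambda>n. f (x - X n * z) * \<phi> z) \<longlonglongrightarrow> f x * \<phi> z" by simp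
  qed (auto simp: norm_mult intro!: mult_right_mono f(2))
  then show ?thesis by simp
qed

text \<open>Both mollified factors are bounded uniformly in \<open>\<epsilon>\<close> and converge at the common continuity
  points, so dominated convergence applies. The limit does not involve the mollifier.\<close>

lemma model_product_reg_dist:
  assumes f: "f \<in> borel_measurable borel" "\<And>x. norm (f x) \<le> C" "AE x in lborel. isCont f x"
    and w: "w \<in> borel_measurable borel" "\<And>x. norm (w x) \<le> D" "AE x in lborel. isCont w x"
  shows "model_product (reg_dist f) (reg_dist w) (reg_dist (\<lambda>x. f x * w x))"
  unfolding model_product_def
proof (intro conjI ballI impI)
  note [measurable] = f(1) w(1)
  have C: "0 \<le> C" and D: "0 \<le> D"
    using f(2)[of 0] w(2)[of 0] norm_ge_zero order_trans by blast+
  show "distribution (reg_dist (\<lambda>x. f x * w x))"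
    by (rule distribution_reg_dist[where C = "C * D"])
      (auto simp: norm_mult intro!: mult_mono f(2) w(2) C)
  fix \<phi> \<psi> assume \<phi>: "\<phi> \<in> test_fun" and int1: "(LINT x|lebesgue. \<phi> x) = 1" and \<psi>: "\<psi> \<in> test_fun"
  note [measurable] = \<phi>[THEN borel_measurable_test_fun] \<psi>[THEN borel_measurable_test_fun]
  have int1: "(LINT z|lborel. \<phi> z) = 1"
    using int1 by (subst (asm) integral_completion) auto
  define L where "L = (LINT z|lborel. norm (\<phi> z))"
  define F where "F \<epsilon> x = (LINT z|lborel. f (x - \<epsilon> * z) * \<phi> z)" for \<epsilon> x
  define W where "W \<epsilon> x = (LINT z|lborel. w (x - \<epsilon> * z) * \<phi> z)" for \<epsilon> x
  have [measurable]: "F \<epsilon> \<in> borel_measurable borel" "W \<epsilon> \<in> borel_measurable borel" for \<epsilon>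
    unfolding F_def W_def by measurable
  have F_le: "norm (F \<epsilon> x) \<le> C * L" and W_le: "norm (W \<epsilon> x) \<le> D * L" for \<epsilon> x
    unfolding F_def W_def L_def by (intro norm_mollified_le f w \<phi>)+
  show "((\<lambda>\<epsilon>. reg_dist (\<lambda>x. dist_conv (reg_dist f) (model_net \<phi> \<epsilon>) x *
          dist_conv (reg_dist w) (model_net \<phi> \<epsilon>) x) \<psi>)
        \<longlongrightarrow> reg_dist (\<lambda>x. f x * w x) \<psi>) (at_right 0)"
    unfolding tendsto_at_iff_sequentially comp_def
  proof (intro allI impI)
    fix X :: "nat \<Rightarrow> real" assume X: "\<forall>i. X i \<in> {0<..} - {0}" "X \<longlonglongrightarrow> 0"
    have conv: "dist_conv (reg_dist f) (model_net \<phi> (X n)) x = F (X n) x"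
      "dist_conv (reg_dist w) (model_net \<phi> (X n)) x = W (X n) x" for n x
      unfolding F_def W_def using X(1) by (auto intro!: dist_conv_model_net \<phi>)
    have "(\<lambda>n. LINT x|lborel. F (X n) x * W (X n) x * \<psi> x) \<longlonglongrightarrow> (LINT x|lborel. f x * w x * \<psi> x)"
    proof (rule integral_dominated_convergence)
      show "integrable lborel (\<lambda>x. (C * L) * (D * L) * norm (\<psi> x))"
        using integrable_test_fun[OF \<psi>] by simp
      show "AE x in lborel. (\<lambda>n. F (X n) x * W (X n) x * \<psi> x) \<longlonglongrightarrow> f x * w x * \<psi> x"
        using f(3) w(3)
      proof eventually_elim
        case (elim x)
        have "(\<lambda>n. F (X n) x) \<longlonglongrightarrow> f x" "(\<lambda>n. W (X n) x) \<longlonglongrightarrow> w x"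
          unfolding F_def W_def
          using mollified_tendsto[OF f(1,2) \<phi> elim(1) X(2)] mollified_tendsto[OF w(1,2) \<phi> elim(2) X(2)]
          by (simp_all add: int1)
        then show ?case by (intro tendsto_intros)
      qed
      show "AE x in lborel. norm (F (X n) x * W (X n) x * \<psi> x) \<le> (C * L) * (D * L) * norm (\<psi> x)" for n
        unfolding norm_mult using order_trans[OF norm_ge_zero F_le]
        by (auto intro!: mult_right_mono mult_mono F_le W_le)
    qed measurable
    then show "(\<lambda>n. reg_dist (\<lambda>x. dist_conv (reg_dist f) (model_net \<phi> (X n)) x *
          dist_conv (reg_dist w) (model_net \<phi> (X n)) x) \<psi>) \<longlonglongrightarrow> reg_dist (\<lambda>x. f x * w x) \<psi>"
      by (simp add: conv reg_dist_lborel)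
  qed
qed

section \<open>Integration by parts for a primitive of an integrable function\<close>

text \<open>Interchange of the order of integration over the triangle \<open>y \<le> x\<close>.\<close>

lemma Fubini_triangle:
  fixes q k :: "real \<Rightarrow> complex"
  assumes q: "integrable lebesgue q" and k: "integrable lebesgue k"
  shows "(LINT x|lebesgue. q x * (LINT y|lebesgue. indicator {..x} y *\<^sub>R k y))
       = (LINT y|lebesgue. k y * (LINT x|lebesgue. indicator {y..} x *\<^sub>R q x))"
proof -
  have sf: "sigma_finite_measure (lebesgue :: real measure)"
  proof -
    obtain A :: "real set set" where "countable A" "A \<subseteq> sets lborel" "\<Union>A = space lborel"
      "\<forall>a\<in>A. emeasure lborel a \<noteq> \<infinity>"
      using lborel.sigma_finite_countable by blast
    then show ?thesis
      unfolding sigma_finite_measure_def by (intro exI[of _ A]) auto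
  qed
  interpret pair_sigma_finite "lebesgue :: real measure" "lebesgue :: real measure"
    using sf by (simp add: pair_sigma_finite_def)
  have [measurable]: "q \<in> borel_measurable lebesgue" "k \<in> borel_measurable lebesgue"
    using q k by auto
  have [measurable]: "(\<lambda>p. fst p) \<in> lebesgue \<Otimes>\<^sub>M lebesgue \<rightarrow>\<^sub>M (borel :: real measure)"
      "(\<lambda>p. snd p) \<in> lebesgue \<Otimes>\<^sub>M lebesgue \<rightarrow>\<^sub>M (borel :: real measure)"
    using measurable_compose[OF measurable_fst, of "\<lambda>x. x" lebesgue borel lebesgue]
      measurable_compose[OF measurable_snd, of "\<lambda>x. x" lebesgue borel lebesgue]
    by (auto simp: measurable_completion)
  define f where "f x y = (if y \<le> x then q x * k y else 0)" for x y
  have f_meas: "case_prod f \<in> borel_measurable (lebesgue \<Otimes>\<^sub>M lebesgue)"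
    unfolding f_def case_prod_beta by measurable
  have prod: "integrable (lebesgue \<Otimes>\<^sub>M lebesgue) (\<lambda>(x, y). q x * k y)"
  proof (rule Fubini_integrable)
    show "integrable lebesgue (\<lambda>x. LINT y|lebesgue. norm (case (x, y) of (x, y) \<Rightarrow> q x * k y))"
      using q by (simp add: norm_mult)
    show "AE x in lebesgue. integrable lebesgue (\<lambda>y. case (x, y) of (x, y) \<Rightarrow> q x * k y)"
      using k by simp
  qed measurable
  have int: "integrable (lebesgue \<Otimes>\<^sub>M lebesgue) (case_prod f)"
    by (rule Bochner_Integration.integrable_bound[OF prod f_meas]) (auto simp: f_def)
  have "f x y = q x * (indicator {..x} y *\<^sub>R k y)" for x y
    by (auto simp: f_def indicator_def)
  then have y_inner: "(LINT y|lebesgue. f x y) = q x * (LINT y|lebesgue. indicator {..x} y *\<^sub>R k y)" for x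
    by (simp only: integral_mult_right_zero)
  have "f x y = k y * (indicator {y..} x *\<^sub>R q x)" for x y
    by (auto simp: f_def indicator_def)
  then have x_inner: "(LINT x|lebesgue. f x y) = k y * (LINT x|lebesgue. indicator {y..} x *\<^sub>R q x)" for y
    by (simp only: integral_mult_right_zero)
  show ?thesis
    using Fubini_integral[OF int] unfolding y_inner x_inner by simp
qed

lemma absolutely_integrable_mult_continuous:
  fixes h \<psi> :: "real \<Rightarrow> complex"
  assumes "h absolutely_integrable_on {a..b}" and "continuous_on {a..b} \<psi>"
  shows "(\<lambda>x. h x * \<psi> x) absolutely_integrable_on {a..b}"
proof -
  have "(\<lambda>x. \<psi> x * h x) absolutely_integrable_on {a..b}"
  proof (rule absolutely_integrable_bounded_measurable_product[OF _ _ _ _ assms(1),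
        where h = "(*)" and f = \<psi>])
    show "bilinear ((*) :: complex \<Rightarrow> complex \<Rightarrow> complex)"
      by (simp add: bilinear_conv_bounded_bilinear bounded_bilinear_mult)
    show "\<psi> \<in> borel_measurable (lebesgue_on {a..b})"
      using assms(2) by (intro continuous_imp_measurable_on_sets_lebesgue) auto
    show "bounded (\<psi> ` {a..b})"
      using assms(2) by (intro compact_imp_bounded compact_continuous_image) auto
  qed auto
  then show ?thesis by (simp add: mult.commute)
qed

text \<open>The primitive of \<open>h\<close> need not be differentiable off a countable set, so this is not an instance of
  integration by parts for pointwise derivatives. Both sides equal the integral of \<open>h y * \<psi>' x\<close> over
  the triangle \<open>a \<le> y \<le> x \<le> b\<close>.\<close>

lemma integral_primitive_by_parts:
  fixes h \<psi> \<psi>' :: "real \<Rightarrow> complex"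
  assumes ab: "a \<le> b" and h: "h absolutely_integrable_on {a..b}"
    and deriv: "\<And>x. x \<in> {a..b} \<Longrightarrow> (\<psi> has_vector_derivative \<psi>' x) (at x within {a..b})"
    and cont: "continuous_on {a..b} \<psi>'"
  shows "integral {a..b} (\<lambda>x. integral {a..x} h * \<psi>' x)
       = integral {a..b} h * \<psi> b - integral {a..b} (\<lambda>x. h x * \<psi> x)"
proof -
  have cont\<psi>: "continuous_on {a..b} \<psi>"
    unfolding continuous_on_eq_continuous_within
    using deriv by (blast intro: has_vector_derivative_continuous)
  define k where "k x = indicator {a..b} x *\<^sub>R h x" for x
  define q where "q x = indicator {a..b} x *\<^sub>R \<psi>' x" for x
  have k: "integrable lebesgue k"
    using h unfolding k_def set_integrable_def .
  have q': "\<psi>' absolutely_integrable_on {a..b}"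
    using cont by (rule absolutely_integrable_continuous_real)
  then have q: "integrable lebesgue q"
    unfolding q_def set_integrable_def .
  have I: "(LINT y|lebesgue. indicator {..x} y *\<^sub>R k y) = integral {a..x} h" if "x \<in> {a..b}" for x
  proof -
    have "h absolutely_integrable_on {a..x}"
      using h that by (auto intro: set_integrable_subset)
    then have "(LINT y:{a..x}|lebesgue. h y) = integral {a..x} h"
      by (rule set_lebesgue_integral_eq_integral)
    moreover have "(\<lambda>y. indicator {..x} y *\<^sub>R k y) = (\<lambda>y. indicator {a..x} y *\<^sub>R h y)"
      using that by (auto simp: k_def indicator_def)
    ultimately show ?thesis by (simp add: set_lebesgue_integral_def)
  qed
  have J: "(LINT x|lebesgue. indicator {y..} x *\<^sub>R q x) = \<psi> b - \<psi> y" if "y \<in> {a..b}" for y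
  proof -
    have "\<psi>' absolutely_integrable_on {y..b}"
      using q' that by (auto intro: set_integrable_subset)
    then have "(LINT x:{y..b}|lebesgue. \<psi>' x) = integral {y..b} \<psi>'"
      by (rule set_lebesgue_integral_eq_integral)
    also have "\<dots> = \<psi> b - \<psi> y"
      using that
      by (intro integral_unique fundamental_theorem_of_calculus)
        (auto intro: has_vector_derivative_within_subset[OF deriv])
    finally have "(LINT x:{y..b}|lebesgue. \<psi>' x) = \<psi> b - \<psi> y" .
    moreover have "(\<lambda>x. indicator {y..} x *\<^sub>R q x) = (\<lambda>x. indicator {y..b} x *\<^sub>R \<psi>' x)"
      using that by (auto simp: q_def indicator_def)
    ultimately show ?thesis by (simp add: set_lebesgue_integral_def)
  qed
  have "(\<lambda>x. integral {a..x} h * \<psi>' x) absolutely_integrable_on {a..b}"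
    using set_lebesgue_integral_eq_integral(1)[OF h]
    by (intro absolutely_integrable_continuous_real continuous_intros cont
        indefinite_integral_continuous_1)
  then have "integral {a..b} (\<lambda>x. integral {a..x} h * \<psi>' x)
      = (LINT x:{a..b}|lebesgue. integral {a..x} h * \<psi>' x)"
    by (rule set_lebesgue_integral_eq_integral(2)[symmetric])
  also have "\<dots> = (LINT x|lebesgue. q x * (LINT y|lebesgue. indicator {..x} y *\<^sub>R k y))"
    unfolding set_lebesgue_integral_def
  proof (rule Bochner_Integration.integral_cong)
    fix x
    show "indicator {a..b} x *\<^sub>R (integral {a..x} h * \<psi>' x)
        = q x * (LINT y|lebesgue. indicator {..x} y *\<^sub>R k y)"
      using I[of x] by (cases "x \<in> {a..b}") (simp_all add: q_def)
  qed simp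
  also have "\<dots> = (LINT y|lebesgue. k y * (LINT x|lebesgue. indicator {y..} x *\<^sub>R q x))"
    by (rule Fubini_triangle[OF q k])
  also have "\<dots> = (LINT y:{a..b}|lebesgue. h y * (\<psi> b - \<psi> y))"
    unfolding set_lebesgue_integral_def
  proof (rule Bochner_Integration.integral_cong)
    fix y
    show "k y * (LINT x|lebesgue. indicator {y..} x *\<^sub>R q x)
        = indicator {a..b} y *\<^sub>R (h y * (\<psi> b - \<psi> y))"
      using J[of y] by (cases "y \<in> {a..b}") (simp_all add: k_def)
  qed simp
  also have "\<dots> = integral {a..b} (\<lambda>y. h y * (\<psi> b - \<psi> y))"
    by (intro set_lebesgue_integral_eq_integral(2) absolutely_integrable_mult_continuous h
        continuous_intros cont\<psi>)
  also have "\<dots> = integral {a..b} (\<lambda>y. h y * \<psi> b - h y * \<psi> y)"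
    by (simp add: right_diff_distrib)
  also have "\<dots> = integral {a..b} (\<lambda>y. h y * \<psi> b) - integral {a..b} (\<lambda>y. h y * \<psi> y)"
    by (intro Henstock_Kurzweil_Integration.integral_diff set_lebesgue_integral_eq_integral(1)
        absolutely_integrable_mult_continuous h cont\<psi> continuous_intros)
  finally show ?thesis by simp
qed

text \<open>Let \<open>F\<close> be continuous with \<open>F a = F b = 0\<close>, and let \<open>F'\<close> agree off finitely many points with one
  primitive \<open>c + \<integral>h\<close>, so that neither \<open>F\<close> nor \<open>F'\<close> jumps inside the interval. Then the extension of
  \<open>F\<close> by zero has the second distributional derivative \<open>h\<close> plus point masses at \<open>a\<close> and \<open>b\<close>, whose
  coefficients are, up to sign, the one-sided values of \<open>F'\<close>; the terms with \<open>\<psi>'\<close> at the endpoints vanish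
  together with \<open>F\<close>.\<close>

lemma integral_mult_second_derivative:
  fixes F h \<psi> \<psi>' \<psi>'' :: "real \<Rightarrow> complex"
  assumes ab: "a \<le> b" and h: "h absolutely_integrable_on {a..b}"
    and F: "continuous_on {a..b} F" "F a = 0" "F b = 0" "finite S"
    and F': "\<And>x. x \<in> {a<..<b} - S \<Longrightarrow> (F has_vector_derivative c + integral {a..x} h) (at x)"
    and deriv: "\<And>x. (\<psi> has_vector_derivative \<psi>' x) (at x)"
      "\<And>x. (\<psi>' has_vector_derivative \<psi>'' x) (at x)"
    and cont: "continuous_on {a..b} \<psi>''"
  shows "integral {a..b} (\<lambda>x. F x * \<psi>'' x)
       = integral {a..b} (\<lambda>x. h x * \<psi> x) + c * \<psi> a - (c + integral {a..b} h) * \<psi> b"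
proof -
  define W where "W x = c + integral {a..x} h" for x
  have cont\<psi>': "continuous_on {a..b} \<psi>'"
    using deriv(2) by (meson continuous_at_imp_continuous_on has_vector_derivative_continuous)
  have contI: "continuous_on {a..b} (\<lambda>x. integral {a..x} h)"
    by (rule indefinite_integral_continuous_1[OF set_lebesgue_integral_eq_integral(1)[OF h]])
  have contW: "continuous_on {a..b} W"
    unfolding W_def by (intro continuous_intros contI)
  have "((\<lambda>x. F x * \<psi>'' x + W x * \<psi>' x) has_integral (F b * \<psi>' b - F a * \<psi>' a)) {a..b}"
  proof (rule fundamental_theorem_of_calculus_interior_strong[OF F(4) ab])
    show "((\<lambda>x. F x * \<psi>' x) has_vector_derivative F x * \<psi>'' x + W x * \<psi>' x) (at x)"
      if "x \<in> {a<..<b} - S" for x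
      using has_vector_derivative_mult[OF F'[OF that] deriv(2)] unfolding W_def .
    show "continuous_on {a..b} (\<lambda>x. F x * \<psi>' x)"
      by (intro continuous_intros F cont\<psi>')
  qed
  then have "integral {a..b} (\<lambda>x. F x * \<psi>'' x + W x * \<psi>' x) = 0"
    using F(2,3) by (simp add: integral_unique)
  moreover have "integral {a..b} (\<lambda>x. F x * \<psi>'' x + W x * \<psi>' x)
      = integral {a..b} (\<lambda>x. F x * \<psi>'' x) + integral {a..b} (\<lambda>x. W x * \<psi>' x)"
    by (intro Henstock_Kurzweil_Integration.integral_add integrable_continuous_interval
        continuous_on_mult F(1) cont cont\<psi>' contW)
  ultimately have F\<psi>'': "integral {a..b} (\<lambda>x. F x * \<psi>'' x) = - integral {a..b} (\<lambda>x. W x * \<psi>' x)"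
    by (simp only: eq_neg_iff_add_eq_0)
  have "integral {a..b} \<psi>' = \<psi> b - \<psi> a"
    by (intro integral_unique fundamental_theorem_of_calculus ab
        has_vector_derivative_at_within[OF deriv(1)])
  then have "integral {a..b} (\<lambda>x. c * \<psi>' x) = c * (\<psi> b - \<psi> a)"
    by simp
  moreover have "integral {a..b} (\<lambda>x. W x * \<psi>' x)
      = integral {a..b} (\<lambda>x. c * \<psi>' x) + integral {a..b} (\<lambda>x. integral {a..x} h * \<psi>' x)"
    unfolding W_def distrib_right
    by (intro Henstock_Kurzweil_Integration.integral_add integrable_continuous_interval
        continuous_on_mult continuous_on_const cont\<psi>' contI)
  moreover have "integral {a..b} (\<lambda>x. integral {a..x} h * \<psi>' x)
       = integral {a..b} h * \<psi> b - integral {a..b} (\<lambda>x. h x * \<psi> x)"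
    by (intro integral_primitive_by_parts ab h cont\<psi>'
        has_vector_derivative_at_within[OF deriv(1)])
  ultimately show ?thesis unfolding F\<psi>'' by (simp add: algebra_simps)
qed

section \<open>One-sided pieces and their first integrals\<close>

lemma continuous_on_Icc_extend:
  fixes v :: "real \<Rightarrow> complex"
  assumes lr: "l < r" and v: "continuous_on {l<..<r} v"
    and lim: "(v \<longlongrightarrow> yl) (at_right l)" "(v \<longlongrightarrow> yr) (at_left r)"
  shows "continuous_on {l..r} (\<lambda>x. if x \<le> l then yl else if r \<le> x then yr else v x)"
    (is "continuous_on _ ?E")
proof (rule continuous_on_IccI)
  have "\<forall>\<^sub>F x in at_right l. v x = ?E x"
    using eventually_at_right_real[OF lr] by eventually_elim simp
  then show "(?E \<longlongrightarrow> ?E l) (at_right l)"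
    using Lim_transform_eventually[OF lim(1)] by simp
  have "\<forall>\<^sub>F x in at_left r. v x = ?E x"
    using eventually_at_left_real[OF lr] by eventually_elim simp
  then show "(?E \<longlongrightarrow> ?E r) (at_left r)"
    using Lim_transform_eventually[OF lim(2)] lr by simp
  show "?E \<midarrow>x\<rightarrow> ?E x" if "l < x" "x < r" for x
  proof -
    have "v \<midarrow>x\<rightarrow> v x"
      using v that by (auto simp: continuous_on_eq_continuous_at isCont_def)
    then have "?E \<midarrow>x\<rightarrow> v x"
      by (rule Lim_transform_within_open[where s = "{l<..<r}"]) (use that in auto)
    then show ?thesis using that by simp
  qed
qed (rule lr)

lemma cutoff_regular:
  fixes v :: "real \<Rightarrow> complex"
  defines "w \<equiv> \<lambda>l r x. if x \<in> {l<..<r} then v x else 0"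
  assumes lr: "l < r" and v: "continuous_on {l<..<r} v"
    and lim: "(v \<longlongrightarrow> yl) (at_right l)" "(v \<longlongrightarrow> yr) (at_left r)"
  shows borel_measurable_cutoff: "w l r \<in> borel_measurable borel"
    and bounded_cutoff: "\<exists>C. \<forall>x. norm (w l r x) \<le> C"
    and isCont_cutoff: "x \<noteq> l \<Longrightarrow> x \<noteq> r \<Longrightarrow> isCont (w l r) x"
proof -
  show "w l r \<in> borel_measurable borel"
    unfolding w_def by (rule borel_measurable_continuous_on_if) (use v in auto)
  let ?E = "\<lambda>x. if x \<le> l then yl else if r \<le> x then yr else v x"
  have "bounded (?E ` {l..r})"
    using continuous_on_Icc_extend[OF lr v lim]
    by (intro compact_imp_bounded compact_continuous_image) auto
  then obtain C where C: "\<forall>y \<in> ?E ` {l..r}. norm y \<le> C"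
    unfolding bounded_iff by blast
  have "norm (w l r x) \<le> max C 0" for x
  proof (cases "x \<in> {l<..<r}")
    case True
    then have "v x \<in> ?E ` {l..r}" by (intro image_eqI[of _ _ x]) auto
    then have "norm (v x) \<le> C" using C by blast
    with True show ?thesis by (simp add: w_def)
  next
    case False
    then show ?thesis by (auto simp: w_def)
  qed
  then show "\<exists>C. \<forall>x. norm (w l r x) \<le> C" by blast
  show "isCont (w l r) x" if x: "x \<noteq> l" "x \<noteq> r"
  proof (cases "x \<in> {l<..<r}")
    case True
    then have "isCont v x" using v by (auto simp: continuous_on_eq_continuous_at)
    moreover have "\<forall>\<^sub>F y in nhds x. w l r y = v y"
      using True by (intro eventually_nhds[THEN iffD2] exI[of _ "{l<..<r}"]) (auto simp: w_def)
    ultimately show ?thesis by (simp only: isCont_cong)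
  next
    case False
    then have "x \<in> - {l..r}" using x by auto
    then have "\<forall>\<^sub>F y in nhds x. w l r y = 0"
      by (intro eventually_nhds[THEN iffD2] exI[of _ "- {l..r}"]) (auto simp: w_def)
    from isCont_cong[OF this] show ?thesis by simp
  qed
qed

text \<open>The equation in integrated form; the exceptional null set of the differential equation
  disappears.\<close>

lemma ode_solution_flux:
  assumes ode: "ode_solution c p g l r v v'" and st: "l < s" "s \<le> t" "t < r"
  shows "of_real c * v' t - of_real c * v' s = integral {s..t} (\<lambda>x. g x - of_real p * v x)"
proof -
  obtain v'' where int: "integral {s..t} v'' = v' t - v' s"
    and ae: "AE x in lebesgue. x \<in> {l<..<r} \<longrightarrow> of_real c * v'' x + of_real p * v x = g x"
  proof -
    obtain v'' where
      "\<forall>s t. l < s \<and> s \<le> t \<and> t < r \<longrightarrow>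
         v'' absolutely_integrable_on {s..t} \<and> v' t - v' s = integral {s..t} v''"
      "AE x in lebesgue. x \<in> {l<..<r} \<longrightarrow> of_real c * v'' x + of_real p * v x = g x"
      using ode unfolding ode_solution_def by blast
    with st that[of v''] show thesis by simp
  qed
  obtain N where N: "{x. \<not> (x \<in> {l<..<r} \<longrightarrow> of_real c * v'' x + of_real p * v x = g x)} \<subseteq> N"
      "negligible N"
    using ae unfolding eventually_ae_filter by (auto simp: negligible_iff_null_sets)
  have "integral {s..t} (\<lambda>x. g x - of_real p * v x) = integral {s..t} (\<lambda>x. of_real c * v'' x)"
  proof (rule integral_spike[OF N(2)])
    fix x assume x: "x \<in> {s..t} - N"
    have "x \<in> {l<..<r}" using x st by simp
    with x N(1) have "of_real c * v'' x + of_real p * v x = g x" by blast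
    then show "of_real c * v'' x = g x - of_real p * v x" by (simp add: algebra_simps)
  qed
  then show ?thesis by (simp add: int right_diff_distrib)
qed

text \<open>The flux \<open>c v'\<close> minus the primitive of \<open>g - p v\<close> is constant, and the constant is its limit along any
  nontrivial filter \<open>F\<close> living on the interval, such as the one-sided filter at an endpoint.
  Here \<open>h\<close> may be any integrable function on a larger interval that agrees with \<open>g - p v\<close> on the
  smaller one, so that the pieces on both sides of an interface share one primitive.\<close>

lemma ode_solution_first_integral:
  assumes ode: "ode_solution c p g l r v v'" and lr: "a \<le> l" "r \<le> b"
    and h: "h integrable_on {a..b}" "\<And>x. x \<in> {l<..<r} \<Longrightarrow> h x = g x - of_real p * v x"
    and z: "((\<lambda>t. of_real c * v' t - integral {a..t} h) \<longlongrightarrow> z) F"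
    and F: "F \<noteq> bot" "\<forall>\<^sub>F t in F. t \<in> {l<..<r}" and x: "x \<in> {l<..<r}"
  shows "of_real c * v' x = z + integral {a..x} h"
proof -
  have *: "of_real c * v' t - integral {a..t} h = of_real c * v' s - integral {a..s} h"
    if "l < s" "s \<le> t" "t < r" for s t
  proof -
    have "integral {a..s} h + integral {s..t} h = integral {a..t} h"
      using that lr h(1)
      by (intro Henstock_Kurzweil_Integration.integral_combine) (auto intro: integrable_on_subinterval[OF h(1)])
    moreover have "integral {s..t} h = integral {s..t} (\<lambda>x. g x - of_real p * v x)"
      using that by (intro Henstock_Kurzweil_Integration.integral_cong h(2)) auto
    ultimately show ?thesis
      using ode_solution_flux[OF ode that] by (simp add: algebra_simps)
  qed
  have "\<forall>\<^sub>F t in F. of_real c * v' x - integral {a..x} h = of_real c * v' t - integral {a..t} h"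
    using F(2)
  proof eventually_elim
    case (elim t)
    then show ?case using *[of x t] *[of t x] x by (cases "x \<le> t") auto
  qed
  then have "((\<lambda>t. of_real c * v' t - integral {a..t} h) \<longlongrightarrow>
      of_real c * v' x - integral {a..x} h) F"
    by (rule Lim_transform_eventually[OF tendsto_const])
  from tendsto_unique[OF F(1) this z] show ?thesis by (simp add: algebra_simps)
qed

section \<open>The discontinuous coefficients\<close>

lemma borel_measurable_heaviside: "heaviside \<in> borel_measurable borel"
  unfolding heaviside_def by measurable

lemma isCont_heaviside:
  assumes "x \<noteq> 0"
  shows "isCont heaviside x"
proof -
  have "\<forall>\<^sub>F y in nhds x. heaviside y = (if x > 0 then 1 else 0)"
    using assms
    by (intro eventually_nhds[THEN iffD2] exI[of _ "if x > 0 then {0<..} else {..<0}"])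
      (auto simp: heaviside_def)
  from isCont_cong[OF this] show ?thesis by simp
qed

lemma step_function_regular:
  fixes p q r s :: real
  defines "f \<equiv> \<lambda>x. complex_of_real (p + q * heaviside (s - x) + r * heaviside (x - s))"
  shows "f \<in> borel_measurable borel" and "norm (f x) \<le> \<bar>p\<bar> + \<bar>q\<bar> + \<bar>r\<bar>"
    and "x \<noteq> s \<Longrightarrow> isCont f x"
proof -
  note [measurable] = borel_measurable_heaviside
  show "f \<in> borel_measurable borel" unfolding f_def by measurable
  show "norm (f x) \<le> \<bar>p\<bar> + \<bar>q\<bar> + \<bar>r\<bar>"
    unfolding f_def norm_of_real by (auto simp: heaviside_def)
  assume x: "x \<noteq> s"
  have "isCont (\<lambda>x. heaviside (s - x)) x" "isCont (\<lambda>x. heaviside (x - s)) x"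
    using x isCont_heaviside[of "s - x"] isCont_heaviside[of "x - s"]
      isCont_o2[of x "\<lambda>x. s - x" heaviside] isCont_o2[of x "\<lambda>x. x - s" heaviside]
    by simp_all
  then show "isCont f x" unfolding f_def by (intro continuous_intros)
qed

section \<open>The glued solution of the transmission problem\<close>

theorem theorem4p5:
  fixes A B x\<^sub>0 P\<^sub>1 P\<^sub>2 :: real
    and g um up u :: "real \<Rightarrow> complex"
    and M N :: "(real \<times> real) set"
  assumes "A > 0" and "B > 0" and "A \<noteq> B"
    and "0 < x\<^sub>0" and "x\<^sub>0 < 1"
    and "g absolutely_integrable_on {0..1}"
    and "admissible_exceptional_pair A B x\<^sub>0 M N"
    and "parameter_case M N P\<^sub>1 P\<^sub>2"
    and "transmission_solution A B x\<^sub>0 P\<^sub>1 P\<^sub>2 g um up"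
    and "u = glue x\<^sub>0 um up"
  shows "distributional_solution
           (reg_dist (\<lambda>x. of_real (coeff_a A B x\<^sub>0 x)))
           (reg_dist (\<lambda>x. of_real (coeff_P P\<^sub>1 P\<^sub>2 x\<^sub>0 x)))
           (reg_dist (\<lambda>x. indicator {0..1} x *\<^sub>R g x))
           (reg_dist u)
         \<and> u 0 = 0 \<and> u 1 = 0 \<and> (u \<longlongrightarrow> 0) (at_right 0) \<and> (u \<longlongrightarrow> 0) (at_left 1)"
proof -
  note x\<^sub>0 = \<open>0 < x\<^sub>0\<close> \<open>x\<^sub>0 < 1\<close> and g = \<open>g absolutely_integrable_on {0..1}\<close>
  obtain um' up' y\<^sub>m y\<^sub>p z\<^sub>m z\<^sub>p where
    ode: "ode_solution A P\<^sub>1 g 0 x\<^sub>0 um um'" "ode_solution B P\<^sub>2 g x\<^sub>0 1 up up'"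
    and ends: "(um \<longlongrightarrow> 0) (at_right 0)" "(up \<longlongrightarrow> 0) (at_left 1)"
    and y: "(um \<longlongrightarrow> y\<^sub>m) (at_left x\<^sub>0)" "(up \<longlongrightarrow> y\<^sub>p) (at_right x\<^sub>0)"
      "of_real A * y\<^sub>m = of_real B * y\<^sub>p"
    and z: "(um' \<longlongrightarrow> z\<^sub>m) (at_left x\<^sub>0)" "(up' \<longlongrightarrow> z\<^sub>p) (at_right x\<^sub>0)"
      "of_real A * z\<^sub>m = of_real B * z\<^sub>p"
    using \<open>transmission_solution A B x\<^sub>0 P\<^sub>1 P\<^sub>2 g um up\<close> unfolding transmission_solution_def by blast
  have um': "(um has_vector_derivative um' x) (at x)" if "x \<in> {0<..<x\<^sub>0}" for x
    using ode(1) that unfolding ode_solution_def by blast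
  have up': "(up has_vector_derivative up' x) (at x)" if "x \<in> {x\<^sub>0<..<1}" for x
    using ode(2) that unfolding ode_solution_def by blast
  have um: "continuous_on {0<..<x\<^sub>0} um"
    using um' has_vector_derivative_continuous by (blast intro: continuous_at_imp_continuous_on)
  have up: "continuous_on {x\<^sub>0<..<1} up"
    using up' has_vector_derivative_continuous by (blast intro: continuous_at_imp_continuous_on)

  have u_eq: "u = (\<lambda>x. (if x \<in> {0<..<x\<^sub>0} then um x else 0) + (if x \<in> {x\<^sub>0<..<1} then up x else 0))"
    unfolding \<open>u = glue x\<^sub>0 um up\<close> glue_def ..
  have u_m: "u x = um x" if "x \<in> {0<..<x\<^sub>0}" for x using that x\<^sub>0 by (auto simp: u_eq)
  have u_p: "u x = up x" if "x \<in> {x\<^sub>0<..<1}" for x using that x\<^sub>0 by (auto simp: u_eq)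
  have u_0: "u x = 0" if "x \<notin> {0<..<1}" for x using that x\<^sub>0 by (auto simp: u_eq)
  have u_meas: "u \<in> borel_measurable borel"
    unfolding u_eq
    by (intro borel_measurable_add borel_measurable_cutoff[OF _ um ends(1) y(1)]
        borel_measurable_cutoff[OF _ up y(2) ends(2)] x\<^sub>0)
  obtain C\<^sub>m where C\<^sub>m: "\<And>x. norm (if x \<in> {0<..<x\<^sub>0} then um x else 0) \<le> C\<^sub>m"
    using bounded_cutoff[OF x\<^sub>0(1) um ends(1) y(1)] by blast
  obtain C\<^sub>p where C\<^sub>p: "\<And>x. norm (if x \<in> {x\<^sub>0<..<1} then up x else 0) \<le> C\<^sub>p"
    using bounded_cutoff[OF x\<^sub>0(2) up y(2) ends(2)] by blast
  have u_le: "norm (u x) \<le> C\<^sub>m + C\<^sub>p" for x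
    unfolding u_eq by (intro norm_triangle_mono C\<^sub>m C\<^sub>p)
  have ae: "AE x in lborel. x \<notin> {0, x\<^sub>0, 1}"
    by (intro AE_not_in finite_imp_null_set_lborel) auto
  have "isCont u x" if "x \<notin> {0, x\<^sub>0, 1}" for x
    unfolding u_eq using that
    by (intro continuous_add isCont_cutoff[OF _ um ends(1) y(1)]
        isCont_cutoff[OF _ up y(2) ends(2)] x\<^sub>0) auto
  with ae have u_cont: "AE x in lborel. isCont u x" by auto

  define a where "a x = complex_of_real (coeff_a A B x\<^sub>0 x)" for x
  define P where "P x = complex_of_real (coeff_P P\<^sub>1 P\<^sub>2 x\<^sub>0 x)" for x
  have a_eq: "a = (\<lambda>x. complex_of_real (0 + A * heaviside (x\<^sub>0 - x) + B * heaviside (x - x\<^sub>0)))"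
    unfolding a_def coeff_a_def by simp
  have P_eq: "P = (\<lambda>x. complex_of_real (P\<^sub>1 + 0 * heaviside (x\<^sub>0 - x) + (P\<^sub>2 - P\<^sub>1) * heaviside (x - x\<^sub>0)))"
    unfolding P_def coeff_P_def by (simp add: mult.commute)
  have a: "a \<in> borel_measurable borel" "\<And>x. norm (a x) \<le> \<bar>0\<bar> + \<bar>A\<bar> + \<bar>B\<bar>"
      "\<And>x. x \<noteq> x\<^sub>0 \<Longrightarrow> isCont a x"
    unfolding a_eq by (fact step_function_regular)+
  have P: "P \<in> borel_measurable borel" "\<And>x. norm (P x) \<le> \<bar>P\<^sub>1\<bar> + \<bar>0\<bar> + \<bar>P\<^sub>2 - P\<^sub>1\<bar>"
      "\<And>x. x \<noteq> x\<^sub>0 \<Longrightarrow> isCont P x"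
    unfolding P_eq by (fact step_function_regular)+
  have a_cont: "AE x in lborel. isCont a x" and P_cont: "AE x in lborel. isCont P x"
    using ae a(3) P(3) by auto
  note [measurable] = u_meas a(1) P(1)
  have prod_au: "model_product (reg_dist a) (reg_dist u) (reg_dist (\<lambda>x. a x * u x))"
    by (rule model_product_reg_dist[OF a(1,2) a_cont u_meas u_le u_cont])
  have prod_Pu: "model_product (reg_dist P) (reg_dist u) (reg_dist (\<lambda>x. P x * u x))"
    by (rule model_product_reg_dist[OF P(1,2) P_cont u_meas u_le u_cont])

  have int_mult: "(\<lambda>x. w x * u x) absolutely_integrable_on {0..1}"
    if "w \<in> borel_measurable borel" "\<And>x. norm (w x) \<le> K" for w K
  proof (rule absolutely_integrable_bounded_borel)
    show "norm (w x * u x) \<le> K * (C\<^sub>m + C\<^sub>p)" for x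
      unfolding norm_mult using order_trans[OF norm_ge_zero that(2)]
      by (intro mult_mono that u_le) auto
  qed (use that in measurable)

  \<comment> \<open>The right-hand side of \<open>(a u)'' = g - P u\<close>. Both one-sided fluxes have the form \<open>c + \<integral>\<^sub>0\<^sup>x h\<close> with
    the same constant \<open>c\<close>: this is the transmission condition for the derivatives.\<close>
  define h where "h x = g x - P x * u x" for x
  have h: "h absolutely_integrable_on {0..1}"
    unfolding h_def by (intro set_integral_diff g int_mult[OF P(1,2)])
  then have h_int: "h integrable_on {0..1}" by (rule set_lebesgue_integral_eq_integral)
  have h_cont: "isCont (\<lambda>x. integral {0..x} h) x\<^sub>0"
    using indefinite_integral_continuous_1[OF h_int] x\<^sub>0
    by (intro continuous_on_interior[of "{0..1}"]) auto
  have h_lim: "((\<lambda>x. integral {0..x} h) \<longlongrightarrow> integral {0..x\<^sub>0} h) (at x\<^sub>0 within S)" for S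
    using continuous_at_imp_continuous_at_within[OF h_cont] by (simp add: continuous_within)
  define c where "c = of_real A * z\<^sub>m - integral {0..x\<^sub>0} h"

  have flux_m: "of_real A * um' x = c + integral {0..x} h" if "x \<in> {0<..<x\<^sub>0}" for x
  proof (rule ode_solution_first_integral[OF ode(1) _ _ h_int _ _ _ _ that])
    show "h x = g x - of_real P\<^sub>1 * um x" if "x \<in> {0<..<x\<^sub>0}" for x
      using that u_m by (auto simp: h_def P_def coeff_P_def heaviside_def)
    show "((\<lambda>t. of_real A * um' t - integral {0..t} h) \<longlongrightarrow> c) (at_left x\<^sub>0)"
      unfolding c_def by (intro tendsto_intros z(1) h_lim)
    show "\<forall>\<^sub>F t in at_left x\<^sub>0. t \<in> {0<..<x\<^sub>0}"
      using eventually_at_left_real[OF x\<^sub>0(1)] .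
  qed (use x\<^sub>0 in auto)
  have flux_p: "of_real B * up' x = c + integral {0..x} h" if "x \<in> {x\<^sub>0<..<1}" for x
  proof (rule ode_solution_first_integral[OF ode(2) _ _ h_int _ _ _ _ that])
    show "h x = g x - of_real P\<^sub>2 * up x" if "x \<in> {x\<^sub>0<..<1}" for x
      using that u_p by (auto simp: h_def P_def coeff_P_def heaviside_def)
    show "((\<lambda>t. of_real B * up' t - integral {0..t} h) \<longlongrightarrow> c) (at_right x\<^sub>0)"
      unfolding c_def z(3) by (intro tendsto_intros z(2) h_lim)
    show "\<forall>\<^sub>F t in at_right x\<^sub>0. t \<in> {x\<^sub>0<..<1}"
      using eventually_at_right_real[OF x\<^sub>0(2)] .
  qed (use x\<^sub>0 in auto)

  \<comment> \<open>The function \<open>a u\<close>, made continuous at \<open>x\<^sub>0\<close> by the transmission condition for the values.\<close>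
  define F where "F x = (if x = x\<^sub>0 then of_real A * y\<^sub>m else a x * u x)" for x
  have F_m: "F x = of_real A * um x" if "x \<in> {0<..<x\<^sub>0}" for x
    using that u_m by (auto simp: F_def a_def coeff_a_def heaviside_def)
  have F_p: "F x = of_real B * up x" if "x \<in> {x\<^sub>0<..<1}" for x
    using that u_p by (auto simp: F_def a_def coeff_a_def heaviside_def)
  have F_ends: "F 0 = 0" "F 1 = 0"
    using x\<^sub>0 u_0 by (auto simp: F_def)
  have "continuous_on ({0..x\<^sub>0} \<union> {x\<^sub>0..1}) F"
  proof (rule continuous_on_closed_Un)
    have "continuous_on {0..x\<^sub>0}
        (\<lambda>x. of_real A * (if x \<le> 0 then 0 else if x\<^sub>0 \<le> x then y\<^sub>m else um x))"
      by (intro continuous_on_mult_left continuous_on_Icc_extend x\<^sub>0 um ends y)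
    then show "continuous_on {0..x\<^sub>0} F"
      by (rule continuous_on_eq) (use F_m F_ends x\<^sub>0 in \<open>auto simp: F_def\<close>)
    have "continuous_on {x\<^sub>0..1}
        (\<lambda>x. of_real B * (if x \<le> x\<^sub>0 then y\<^sub>p else if 1 \<le> x then 0 else up x))"
      by (intro continuous_on_mult_left continuous_on_Icc_extend x\<^sub>0 up ends y)
    then show "continuous_on {x\<^sub>0..1} F"
      by (rule continuous_on_eq) (use F_p F_ends x\<^sub>0 y(3) in \<open>auto simp: F_def\<close>)
  qed auto
  moreover have "{0..x\<^sub>0} \<union> {x\<^sub>0..1} = {0..1}" using x\<^sub>0 by auto
  ultimately have F_cont: "continuous_on {0..1} F" by simp
  have F': "(F has_vector_derivative c + integral {0..x} h) (at x)" if x: "x \<in> {0<..<1} - {x\<^sub>0}" for x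
  proof (cases "x < x\<^sub>0")
    case True
    then have x: "x \<in> {0<..<x\<^sub>0}" using x by auto
    have "((\<lambda>x. of_real A * um x) has_vector_derivative c + integral {0..x} h) (at x)"
      unfolding flux_m[OF x, symmetric] by (intro has_vector_derivative_mult_right um' x)
    then show ?thesis
      by (rule has_vector_derivative_transform_within_open[of _ _ _ "{0<..<x\<^sub>0}"]) (use x F_m in auto)
  next
    case False
    then have x: "x \<in> {x\<^sub>0<..<1}" using x by auto
    have "((\<lambda>x. of_real B * up x) has_vector_derivative c + integral {0..x} h) (at x)"
      unfolding flux_p[OF x, symmetric] by (intro has_vector_derivative_mult_right up' x)
    then show ?thesis
      by (rule has_vector_derivative_transform_within_open[of _ _ _ "{x\<^sub>0<..<1}"]) (use x F_p in auto)
  qed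

  have eq: "dist_deriv (dist_deriv (reg_dist (\<lambda>x. a x * u x))) \<psi> + reg_dist (\<lambda>x. P x * u x) \<psi>
      = reg_dist (\<lambda>x. indicator {0..1} x *\<^sub>R g x) \<psi> + c * \<psi> 0 + - (c + integral {0..1} h) * \<psi> 1"
    if \<psi>: "\<psi> \<in> test_fun" for \<psi>
  proof -
    define \<psi>' where "\<psi>' x = vector_derivative \<psi> (at x)" for x
    define \<psi>'' where "\<psi>'' x = vector_derivative \<psi>' (at x)" for x
    have \<psi>': "\<psi>' \<in> test_fun"
      using test_fun_vector_derivative[OF \<psi>] by (simp add: \<psi>'_def[abs_def])
    have \<psi>'': "\<psi>'' \<in> test_fun"
      using test_fun_vector_derivative[OF \<psi>'] by (simp add: \<psi>''_def[abs_def])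
    have "dist_deriv (dist_deriv (reg_dist (\<lambda>x. a x * u x))) \<psi> = reg_dist (\<lambda>x. a x * u x) \<psi>''"
      by (simp add: dist_deriv_def \<psi>'_def[abs_def] \<psi>''_def[abs_def])
    also have "\<dots> = integral {0..1} (\<lambda>x. a x * u x * \<psi>'' x)"
      using u_0
      by (intro reg_dist_eq_integral absolutely_integrable_mult_continuous int_mult[OF a(1,2)]
          continuous_on_test_fun \<psi>'') auto
    also have "\<dots> = integral {0..1} (\<lambda>x. F x * \<psi>'' x)"
      by (rule integral_spike[of "{x\<^sub>0}"]) (auto simp: F_def)
    also have "\<dots> = integral {0..1} (\<lambda>x. h x * \<psi> x) + c * \<psi> 0 - (c + integral {0..1} h) * \<psi> 1"
      by (rule integral_mult_second_derivative[where S = "{x\<^sub>0}" and \<psi>' = \<psi>'])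
        (use h F_cont F_ends F' test_fun_has_vector_derivative[OF \<psi>] continuous_on_test_fun[OF \<psi>'']
          test_fun_has_vector_derivative[OF \<psi>'] in \<open>auto simp: \<psi>'_def \<psi>''_def\<close>)
    finally have 1: "dist_deriv (dist_deriv (reg_dist (\<lambda>x. a x * u x))) \<psi>
      = integral {0..1} (\<lambda>x. h x * \<psi> x) + c * \<psi> 0 - (c + integral {0..1} h) * \<psi> 1" .
    have int: "(\<lambda>x. g x * \<psi> x) absolutely_integrable_on {0..1}"
      "(\<lambda>x. P x * u x * \<psi> x) absolutely_integrable_on {0..1}"
      by (intro absolutely_integrable_mult_continuous g int_mult[OF P(1,2)] continuous_on_test_fun \<psi>)+
    have 2: "reg_dist (\<lambda>x. P x * u x) \<psi> = integral {0..1} (\<lambda>x. P x * u x * \<psi> x)"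
      using u_0 by (intro reg_dist_eq_integral int) auto
    have "reg_dist (\<lambda>x. indicator {0..1} x *\<^sub>R g x) \<psi> = (LINT x:{0..1}|lebesgue. g x * \<psi> x)"
      by (simp add: reg_dist_def set_lebesgue_integral_def)
    also have "\<dots> = integral {0..1} (\<lambda>x. g x * \<psi> x)"
      by (rule set_lebesgue_integral_eq_integral(2)[OF int(1)])
    finally have 3: "reg_dist (\<lambda>x. indicator {0..1} x *\<^sub>R g x) \<psi> = integral {0..1} (\<lambda>x. g x * \<psi> x)" .
    have "integral {0..1} (\<lambda>x. h x * \<psi> x)
        = integral {0..1} (\<lambda>x. g x * \<psi> x) - integral {0..1} (\<lambda>x. P x * u x * \<psi> x)"
      unfolding h_def left_diff_distrib
      by (intro Henstock_Kurzweil_Integration.integral_diff set_lebesgue_integral_eq_integral(1) int)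
    then show ?thesis unfolding 1 2 3 by (simp add: algebra_simps)
  qed

  have "distributional_solution (reg_dist a) (reg_dist P)
      (reg_dist (\<lambda>x. indicator {0..1} x *\<^sub>R g x)) (reg_dist u)"
    unfolding distributional_solution_def
  proof (intro conjI)
    show "distribution (reg_dist u)" by (rule distribution_reg_dist[OF u_meas u_le])
    show "dsupport (reg_dist u) \<subseteq> {0..1}"
      using u_0 by (intro dsupport_reg_dist_subset) auto
    show "\<exists>au Pu. model_product (reg_dist a) (reg_dist u) au \<and> model_product (reg_dist P) (reg_dist u) Pu \<and>
        (\<exists>c\<^sub>0 c\<^sub>1. \<forall>\<psi>\<in>test_fun. dist_deriv (dist_deriv au) \<psi> + Pu \<psi>
          = reg_dist (\<lambda>x. indicator {0..1} x *\<^sub>R g x) \<psi> + c\<^sub>0 * \<psi> 0 + c\<^sub>1 * \<psi> 1)"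
      using prod_au prod_Pu eq by blast
  qed
  moreover have "u 0 = 0" "u 1 = 0" using u_0 by auto
  moreover have "(u \<longlongrightarrow> 0) (at_right 0)"
  proof (rule Lim_transform_eventually[OF ends(1)])
    show "\<forall>\<^sub>F x in at_right 0. um x = u x"
      using eventually_at_right_real[OF x\<^sub>0(1)] by eventually_elim (simp add: u_m)
  qed
  moreover have "(u \<longlongrightarrow> 0) (at_left 1)"
  proof (rule Lim_transform_eventually[OF ends(2)])
    show "\<forall>\<^sub>F x in at_left 1. up x = u x"
      using eventually_at_left_real[OF x\<^sub>0(2)] by eventually_elim (simp add: u_p)
  qed
  ultimately show ?thesis unfolding a_def P_def by blast
qed

end
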